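(* Let $u$ be a set and let $W:\mathcal{P}(u)\to\mathcal{P}(u)$ be a monotonic and strict set transformer ($W(\varnothing)=\varnothing$). For $r\subseteq u$ let $\mathcal{F}(r):\mathcal{P}(u)\to\mathcal{P}(u)$ be the set transformer $\mathcal{F}(r)(x)=r\cup W(x)$ (the guarded set transformer $\overline{r}\Longrightarrow W$), and let $\mathrm{fix}(\mathcal{F}(r))$ denote its least fixpoint. Define the termination relation $$\mathcal{T}=\{(a,b)\mid a\subseteq u,\ b\subseteq u,\ a\subseteq \mathrm{fix}(\mathcal{F}(b))\}.$$ Let $\mathcal{E}\subseteq\mathcal{P}(u)\times\mathcal{P}(u)$ be a relation, and let $\mathcal{L}\subseteq\mathcal{P}(u)\times\mathcal{P}(u)$ be the reachability relation generated by $\mathcal{E}$, i.e. the smallest relation such that (SBR) $\mathcal{E}\subseteq\mathcal{L}$; (STR) if $(a,c)\in\mathcal{L}$ and $(c,b)\in\mathcal{L}$ then $(a,b)\in\mathcal{L}$; (SDR) for every $q\subseteq u$ and every family $l\subseteq\mathcal{P}(u)$, if $(p,q)\in\mathcal{L}$ for all $p\in l$ then $(\bigcup l,q)\in\mathcal{L}$. Assume that for all $a,b,r\subseteq u$: (a) if $(a,b)\in\mathcal{E}$ then $a\cap\overline{b}\subseteq W(b)$; (b) if $a\subseteq b$ then $(a,b)\in\mathcal{E}$; (c) $(W(r),r)\in\mathcal{L}$. Then $\mathcal{L}=\mathcal{T}$.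
   Context: A set transformer on $u$ is a total function $\mathcal{P}(u)\to\mathcal{P}(u)$. For $p\subseteq u$, $\overline{p}$ denotes $u\setminus p$. Least fixpoints exist by the Knaster–Tarski theorem since $\mathcal{F}(r)$ is monotonic. *)

theory Defs
  imports "HOL-Library.FuncSet"
begin

definition guarded :: "('a set \<Rightarrow> 'a set) \<Rightarrow> 'a set \<Rightarrow> 'a set \<Rightarrow> 'a set" where
  "guarded W r x = r \<union> W x"

text \<open>The least fixpoint is taken inside the lattice of subsets of \<open>u\<close>. The constant \<^const>\<open>lfp\<close>
  would range over all sets of the type, where a set transformer on \<open>u\<close> is unconstrained and
  need not be monotonic.\<close>

definition fix_on :: "'a set \<Rightarrow> ('a set \<Rightarrow> 'a set) \<Rightarrow> 'a set" where
  "fix_on u f = (LEAST x. x \<subseteq> u \<and> f x = x)"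

lemma fix_on_least:
  assumes f: "f \<in> Pow u \<rightarrow> Pow u" and m: "mono_on (Pow u) f"
  shows "fix_on u f \<subseteq> u" and "f (fix_on u f) = fix_on u f"
    and "\<And>y. y \<subseteq> u \<Longrightarrow> f y = y \<Longrightarrow> fix_on u f \<subseteq> y"
proof -
  define m0 where "m0 = \<Inter>{x \<in> Pow u. f x \<subseteq> x}"
  have U: "u \<in> {x \<in> Pow u. f x \<subseteq> x}" using f by auto
  have m0u: "m0 \<subseteq> u" using U unfolding m0_def by blast
  have le: "m0 \<subseteq> x" if "x \<subseteq> u" "f x \<subseteq> x" for x using that unfolding m0_def by blast
  have pre: "f m0 \<subseteq> m0"
  proof -
    have "f m0 \<subseteq> x" if x: "x \<subseteq> u" "f x \<subseteq> x" for x
      using mono_onD[OF m, of m0 x] le[OF x] m0u x by auto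
    then show ?thesis unfolding m0_def by blast
  qed
  have fu: "f m0 \<subseteq> u" using pre m0u by blast
  have "f (f m0) \<subseteq> f m0" using mono_onD[OF m, of "f m0" m0] fu m0u pre by auto
  then have fp: "f m0 = m0" using le[OF fu] pre by blast
  have "fix_on u f = m0" unfolding fix_on_def
    by (rule Least_equality) (use fp m0u le in auto)
  then show "fix_on u f \<subseteq> u" and "f (fix_on u f) = fix_on u f"
    and "\<And>y. y \<subseteq> u \<Longrightarrow> f y = y \<Longrightarrow> fix_on u f \<subseteq> y"
    using m0u fp le by auto
qed

definition termination_rel :: "'a set \<Rightarrow> ('a set \<Rightarrow> 'a set) \<Rightarrow> ('a set \<times> 'a set) set" where
  "termination_rel u W = {(a, b). a \<subseteq> u \<and> b \<subseteq> u \<and> a \<subseteq> fix_on u (guarded W b)}"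

inductive_set reach :: "'a set \<Rightarrow> ('a set \<times> 'a set) set \<Rightarrow> ('a set \<times> 'a set) set"
  for u :: "'a set" and E :: "('a set \<times> 'a set) set" where
  SBR: "(a, b) \<in> E \<Longrightarrow> (a, b) \<in> reach u E"
| STR: "(a, c) \<in> reach u E \<Longrightarrow> (c, b) \<in> reach u E \<Longrightarrow> (a, b) \<in> reach u E"
| SDR: "q \<subseteq> u \<Longrightarrow> l \<subseteq> Pow u \<Longrightarrow> (\<And>p. p \<in> l \<Longrightarrow> (p, q) \<in> reach u E) \<Longrightarrow> (\<Union>l, q) \<in> reach u E"

end

theory Submission
  imports Defs
begin

text \<open>For soundness, the termination relation is closed under the three generating rules;
  transitivity holds since \<open>c \<subseteq> fix \<F>(b)\<close> makes \<open>fix \<F>(b)\<close> a prefixpoint of \<open>\<F>(c)\<close>.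
  For completeness, the union \<open>M\<close> of all sets leading to \<open>b\<close> itself leads to \<open>b\<close>. As \<open>W(M)\<close>
  leads to \<open>M\<close>, and hence to \<open>b\<close>, \<open>M\<close> is a prefixpoint of \<open>\<F>(b)\<close>, so it contains
  \<open>fix \<F>(b)\<close>.\<close>

text \<open>\<open>fix_on_least\<close> compares the least fixpoint only with other fixpoints; both
  inclusions of the theorem need the comparison with prefixpoints.\<close>

lemma fix_on_lowerbound:
  assumes f: "f \<in> Pow u \<rightarrow> Pow u" and m: "mono_on (Pow u) f"
    and y: "y \<subseteq> u" "f y \<subseteq> y"
  shows "fix_on u f \<subseteq> y"
proof -
  \<comment> \<open>\<open>f\<close> restricts to the subsets of \<open>y\<close>, so it has a fixpoint below \<open>y\<close>.\<close>
  have fy: "f \<in> Pow y \<rightarrow> Pow y"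
  proof
    fix x assume "x \<in> Pow y"
    then have "f x \<subseteq> f y" using mono_onD[OF m, of x y] y by auto
    then show "f x \<in> Pow y" using y by auto
  qed
  have my: "mono_on (Pow y) f" using m y by (auto intro: mono_on_subset)
  show ?thesis
    using fix_on_least(1,2)[OF fy my] fix_on_least(3)[OF f m, of "fix_on y f"] y by auto
qed

lemma guarded_funcset:
  assumes "W \<in> Pow u \<rightarrow> Pow u" "r \<subseteq> u"
  shows "guarded W r \<in> Pow u \<rightarrow> Pow u"
  using assms unfolding guarded_def by blast

lemma mono_on_guarded:
  assumes "mono_on A W"
  shows "mono_on A (guarded W r)"
  using assms by (fastforce simp: guarded_def mono_on_def)

text \<open>This keeps the union of all sets leading to \<open>b\<close> inside \<open>u\<close>,
  where \<open>incl\<close> and \<open>WE\<close> apply to it.\<close>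

lemma reach_subset:
  assumes "(a, b) \<in> reach u E" "E \<subseteq> Pow u \<times> Pow u"
  shows "a \<subseteq> u \<and> b \<subseteq> u"
  using assms by induction auto

context
  fixes u :: "'a set" and W :: "'a set \<Rightarrow> 'a set"
  assumes W: "W \<in> Pow u \<rightarrow> Pow u" and mono: "mono_on (Pow u) W"
begin

lemma fix_on_guarded:
  assumes "b \<subseteq> u"
  shows "fix_on u (guarded W b) \<subseteq> u" "b \<union> W (fix_on u (guarded W b)) = fix_on u (guarded W b)"
  using fix_on_least(1,2)[OF guarded_funcset[OF W assms] mono_on_guarded[OF mono]]
  by (auto simp: guarded_def)

lemma fix_on_guarded_lowerbound:
  assumes "b \<subseteq> u" "y \<subseteq> u" "b \<subseteq> y" "W y \<subseteq> y"
  shows "fix_on u (guarded W b) \<subseteq> y"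
  by (rule fix_on_lowerbound[OF guarded_funcset[OF W] mono_on_guarded[OF mono]])
    (use assms in \<open>auto simp: guarded_def\<close>)

lemma reach_subset_termination_rel:
  assumes E: "E \<subseteq> Pow u \<times> Pow u"
    and step: "\<And>a b. (a, b) \<in> E \<Longrightarrow> a - b \<subseteq> W b"
  shows "reach u E \<subseteq> termination_rel u W"
proof (intro subrelI)
  fix a b assume "(a, b) \<in> reach u E"
  then show "(a, b) \<in> termination_rel u W"
  proof induction
    case (SBR a b)
    then have ab: "a \<subseteq> u" "b \<subseteq> u" using E by auto
    let ?F = "fix_on u (guarded W b)"
    note F = fix_on_guarded[OF ab(2)]
    \<comment> \<open>As \<open>b\<close> lies in \<open>?F\<close>, monotonicity gives \<open>a
      \<subseteq> b \<union> W b \<subseteq> b \<union> W ?F = ?F\<close>.\<close>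
    have "W b \<subseteq> W ?F" using mono_onD[OF mono, of b ?F] F ab by auto
    then show ?case using step[OF SBR] F ab by (auto simp: termination_rel_def)
  next
    case (STR a c b)
    then have c: "c \<subseteq> u" "b \<subseteq> u" "c \<subseteq> fix_on u (guarded W b)"
      by (auto simp: termination_rel_def)
    have "fix_on u (guarded W c) \<subseteq> fix_on u (guarded W b)"
      by (rule fix_on_guarded_lowerbound) (use c fix_on_guarded[OF c(2)] in auto)
    then show ?case using STR by (auto simp: termination_rel_def)
  next
    case (SDR q l)
    \<comment> \<open>All members of \<open>l\<close> lie below the same fixpoint, hence so does
      their union; if \<open>l\<close> is empty, only \<open>q \<subseteq> u\<close>
      matters.\<close>
    then show ?case unfolding termination_rel_def by blast
  qed
qed

lemma termination_rel_subset_reach: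
  assumes E: "E \<subseteq> Pow u \<times> Pow u"
    and incl: "\<And>a b. b \<subseteq> u \<Longrightarrow> a \<subseteq> b \<Longrightarrow> (a, b) \<in> E"
    and WE: "\<And>r. r \<subseteq> u \<Longrightarrow> (W r, r) \<in> reach u E"
  shows "termination_rel u W \<subseteq> reach u E"
proof (intro subrelI)
  fix a b assume "(a, b) \<in> termination_rel u W"
  then have ab: "b \<subseteq> u" "a \<subseteq> fix_on u (guarded W b)"
    by (auto simp: termination_rel_def)
  define M where "M = \<Union>{p. (p, b) \<in> reach u E}"
  have Mu: "M \<subseteq> u" using reach_subset[OF _ E] unfolding M_def by blast
  have Mb: "(M, b) \<in> reach u E"
    unfolding M_def by (rule SDR) (use ab reach_subset[OF _ E] in blast)+
  \<comment> \<open>By \<open>incl\<close>, \<open>b\<close> leads to itself, so it is one of the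
    sets united in \<open>M\<close>.\<close>
  have "b \<subseteq> M" unfolding M_def using SBR[OF incl[OF ab(1) subset_refl]] by blast
  moreover have "W M \<subseteq> M" using STR[OF WE[OF Mu] Mb] M_def by auto
  ultimately have "a \<subseteq> M" using fix_on_guarded_lowerbound[OF ab(1) Mu] ab by blast
  \<comment> \<open>The inclusion \<open>a \<subseteq> M\<close> is itself a basic step from
    \<open>a\<close> to \<open>M\<close>, and \<open>M\<close> leads to \<open>b\<close>.\<close>
  then show "(a, b) \<in> reach u E" using STR[OF SBR[OF incl[OF Mu]] Mb] by blast
qed

end

theorem theorem2:
  fixes u :: "'a set"
    and W :: "'a set \<Rightarrow> 'a set"
    and E :: "('a set \<times> 'a set) set"
  assumes "W \<in> Pow u \<rightarrow> Pow u"
    and "mono_on (Pow u) W"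
    and "W {} = {}"
    and "E \<subseteq> Pow u \<times> Pow u"
    and "\<And>a b. a \<subseteq> u \<Longrightarrow> b \<subseteq> u \<Longrightarrow> (a, b) \<in> E \<Longrightarrow> a \<inter> (u - b) \<subseteq> W b"
    and "\<And>a b. a \<subseteq> u \<Longrightarrow> b \<subseteq> u \<Longrightarrow> a \<subseteq> b \<Longrightarrow> (a, b) \<in> E"
    and "\<And>r. r \<subseteq> u \<Longrightarrow> (W r, r) \<in> reach u E"
  shows "reach u E = termination_rel u W"
proof (rule subset_antisym)
  show "reach u E \<subseteq> termination_rel u W"
  proof (rule reach_subset_termination_rel[OF assms(1,2,4)])
    fix a b assume ab: "(a, b) \<in> E"
    then have "a \<subseteq> u" "b \<subseteq> u" using assms(4) by auto
    then show "a - b \<subseteq> W b" using assms(5)[OF _ _ ab] by blast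
  qed
  show "termination_rel u W \<subseteq> reach u E"
    by (rule termination_rel_subset_reach[OF assms(1,2,4)]) (use assms(6,7) in auto)
qed

end
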